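(* Let $c<d$ be real numbers and let $\alpha,\beta,\gamma,\delta,\omega_1,\omega_2\in\mathbb{C}$ with $\mathrm{Re}(\alpha),\mathrm{Re}(\beta),\mathrm{Re}(\gamma)>0$. The operator ${}_c\mathfrak{I}_{\alpha,\beta,\gamma}^{\delta;\omega_1,\omega_2}$ is bounded on $L^1(c,d)$, with $$\left\Vert{}_c\mathfrak{I}_{\alpha,\beta,\gamma}^{\delta;\omega_1,\omega_2}f\right\Vert_1\leq A\left\Vert f\right\Vert_1,\qquad f\in L^1(c,d),$$ where $A$ is the constant (independent of $f$) $$A=\sum_{k=0}^{\infty}\sum_{l=0}^{\infty}\frac{|(\delta)_{k+l}|\,|\omega_1|^k|\omega_2|^l}{\mathrm{Re}(\alpha k+\beta l+\gamma)\,|\Gamma(\alpha k+\beta l+\gamma)|}\cdot\frac{(d-c)^{\mathrm{Re}(\alpha k+\beta l+\gamma)}}{k!\,l!}.$$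
   Context: For $\alpha,\beta,\gamma,\delta\in\mathbb{C}$ with $\mathrm{Re}(\alpha)>0$, $\mathrm{Re}(\beta)>0$ and $x,y\in\mathbb{C}$, the bivariate Mittag-Leffler function is $$E_{\alpha,\beta,\gamma}^{\delta}(x,y)=\sum_{k=0}^{\infty}\sum_{l=0}^{\infty}\frac{(\delta)_{k+l}}{\Gamma(\alpha k+\beta l+\gamma)}\cdot\frac{x^ky^l}{k!\,l!}$$ (the double series converges absolutely), where $(a)_n=a(a+1)\cdots(a+n-1)$, $(a)_0=1$, is the Pochhammer symbol. For $\mathrm{Re}(\alpha),\mathrm{Re}(\beta),\mathrm{Re}(\gamma)>0$ and $f\in L^1(c,d)$, the associated fractional integral operator is $$\Big({}_c\mathfrak{I}_{\alpha,\beta,\gamma}^{\delta;\omega_1,\omega_2}f\Big)(x)=\int_c^x(x-\xi)^{\gamma-1}E_{\alpha,\beta,\gamma}^{\delta}\left(\omega_1(x-\xi)^{\alpha},\omega_2(x-\xi)^{\beta}\right)f(\xi)\,\mathrm{d}\xi,\qquad x\in(c,d)$$ (defined for almost every $x$). Complex powers of positive reals are principal. *)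

theory Defs
  imports "HOL-Analysis.Analysis"
begin

text \<open>In the library \<^term>\<open>Gamma z = 0\<close> at the poles and division by zero gives zero, so
  dividing by \<^const>\<open>Gamma\<close> below agrees with the convention that the reciprocal Gamma function
  vanishes there.\<close>

definition mittag_leffler2 ::
    "complex \<Rightarrow> complex \<Rightarrow> complex \<Rightarrow> complex \<Rightarrow> complex \<Rightarrow> complex \<Rightarrow> complex" where
  "mittag_leffler2 \<alpha> \<beta> \<gamma> \<delta> x y =
     (\<Sum>k. \<Sum>l. pochhammer \<delta> (k + l) / Gamma (\<alpha> * of_nat k + \<beta> * of_nat l + \<gamma>)
                * (x ^ k * y ^ l / (fact k * fact l)))"

definition ml_kernel ::
    "complex \<Rightarrow> complex \<Rightarrow> complex \<Rightarrow> complex \<Rightarrow> complex \<Rightarrow> complex \<Rightarrow> real \<Rightarrow> complex" where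
  "ml_kernel \<alpha> \<beta> \<gamma> \<delta> \<omega>1 \<omega>2 t =
     complex_of_real t powr (\<gamma> - 1)
     * mittag_leffler2 \<alpha> \<beta> \<gamma> \<delta>
         (\<omega>1 * complex_of_real t powr \<alpha>) (\<omega>2 * complex_of_real t powr \<beta>)"

definition ml_integral ::
    "real \<Rightarrow> complex \<Rightarrow> complex \<Rightarrow> complex \<Rightarrow> complex \<Rightarrow> complex \<Rightarrow> complex
       \<Rightarrow> (real \<Rightarrow> complex) \<Rightarrow> real \<Rightarrow> complex" where
  "ml_integral c \<alpha> \<beta> \<gamma> \<delta> \<omega>1 \<omega>2 f x =
     (LINT \<xi>:{c<..<x}|lebesgue. ml_kernel \<alpha> \<beta> \<gamma> \<delta> \<omega>1 \<omega>2 (x - \<xi>) * f \<xi>)"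

text \<open>Elements of \<open>L\<^sup>1(c,d)\<close> are represented by functions \<open>f\<close> that satisfy
  \<open>f absolutely_integrable_on {c<..<d}\<close>; equality in \<open>L\<^sup>1(c,d)\<close> is equality almost everywhere
  on \<open>{c<..<d}\<close>, and values outside this interval are irrelevant.\<close>

definition L1_norm :: "real \<Rightarrow> real \<Rightarrow> (real \<Rightarrow> complex) \<Rightarrow> real" where
  "L1_norm c d f = (LINT x:{c<..<d}|lebesgue. cmod (f x))"

definition ml_bound_term ::
    "real \<Rightarrow> real \<Rightarrow> complex \<Rightarrow> complex \<Rightarrow> complex \<Rightarrow> complex \<Rightarrow> complex \<Rightarrow> complex
       \<Rightarrow> nat \<Rightarrow> nat \<Rightarrow> real" where
  "ml_bound_term c d \<alpha> \<beta> \<gamma> \<delta> \<omega>1 \<omega>2 k l =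
     cmod (pochhammer \<delta> (k + l)) * cmod \<omega>1 ^ k * cmod \<omega>2 ^ l
     / (Re (\<alpha> * of_nat k + \<beta> * of_nat l + \<gamma>) * cmod (Gamma (\<alpha> * of_nat k + \<beta> * of_nat l + \<gamma>)))
     * ((d - c) powr Re (\<alpha> * of_nat k + \<beta> * of_nat l + \<gamma>) / (fact k * fact l))"

definition ml_bound ::
    "real \<Rightarrow> real \<Rightarrow> complex \<Rightarrow> complex \<Rightarrow> complex \<Rightarrow> complex \<Rightarrow> complex \<Rightarrow> complex \<Rightarrow> real" where
  "ml_bound c d \<alpha> \<beta> \<gamma> \<delta> \<omega>1 \<omega>2 = (\<Sum>k. \<Sum>l. ml_bound_term c d \<alpha> \<beta> \<gamma> \<delta> \<omega>1 \<omega>2 k l)"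

end

theory Submission
  imports Defs
begin

text \<open>
  On \<open>(c, d)\<close> the operator is convolution with the kernel restricted to \<open>0 < t < d - c\<close>: when \<open>x\<close> and
  \<open>\<xi>\<close> both lie in \<open>(c, d)\<close>, the condition \<open>0 < x - \<xi> < d - c\<close> says exactly \<open>\<xi> < x\<close>. By Fubini, the
  convolution of two integrable functions exists almost everywhere, is integrable, and has norm at
  most the product of the norms (\<open>convolution_integrable\<close>). So everything reduces to showing that the
  truncated kernel is integrable with \<open>L\<^sup>1\<close> norm at most the constant \<open>A\<close>.

  For that, write \<open>z = \<alpha> k + \<beta> l + \<gamma>\<close>. The absolute value of the \<open>(k, l)\<close> term of the kernel is a
  constant times \<open>t powr (Re z - 1)\<close>, whose integral over \<open>(0, d - c)\<close> is \<open>(d - c) powr Re z / Re z\<close>;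
  the result is the \<open>(k, l)\<close> term of \<open>A\<close>. Integration in the extended nonnegative reals may be
  interchanged with the double sum without any convergence hypothesis
  (\<open>nn_integral_ml_kernel_le\<close>), so what remains is that \<open>A\<close> is finite.

  Finiteness of \<open>A\<close> is the analytic core, because for complex \<open>\<alpha>\<close> and \<open>\<beta>\<close> the imaginary part of \<open>z\<close>
  grows with \<open>k + l\<close> and makes \<open>cmod (Gamma z)\<close> smaller than \<open>Gamma (Re z)\<close>. The loss is at most
  exponential in \<open>\<bar>Im z\<bar>\<close>, whereas the decay of \<open>1 / Gamma z\<close> in \<open>Re z\<close> is faster than any
  exponential (\<open>rGamma_exponential_bound\<close>). As \<open>\<bar>Im z\<bar>\<close> grows at most linearly and \<open>Re z\<close> at least
  linearly in \<open>k + l\<close>, the decay in \<open>Re z\<close> can be chosen to beat all other factors, which are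
  exponential in \<open>k + l\<close>, and the terms are dominated by a multiple of \<open>(1/2) ^ (k + l)\<close>
  (\<open>ml_bound_term_geometric\<close>).
\<close>

section \<open>Decay of the reciprocal Gamma function in the right half plane\<close>

lemma norm_Gamma_le_Gamma_Re:
  assumes "Re z > 0"
  shows "cmod (Gamma z) \<le> Gamma (Re z)"
proof -
  have G: "((\<lambda>t. of_real t powr (z - 1) / of_real (exp t)) has_integral Gamma z) {0..}"
    by (rule Gamma_integral_complex) fact
  have R: "((\<lambda>t. t powr (Re z - 1) / exp t) has_integral Gamma (Re z)) {0..}"
    by (rule Gamma_integral_real) fact
  have "cmod (integral {0..} (\<lambda>t. of_real t powr (z - 1) / of_real (exp t)))
      \<le> integral {0..} (\<lambda>t. t powr (Re z - 1) / exp t)"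
    using G R
    by (intro integral_norm_bound_integral)
       (auto simp: has_integral_integrable norm_divide norm_powr_real_powr)
  then show ?thesis
    using G R by (simp add: integral_unique)
qed

lemma norm_sin_le_exp_Im: "cmod (sin w) \<le> exp \<bar>Im w\<bar>"
proof -
  have "cmod (sin w) = cmod (exp (\<i> * w) - exp (- (\<i> * w))) / 2"
    by (simp add: sin_exp_eq norm_divide norm_mult)
  also have "\<dots> \<le> (cmod (exp (\<i> * w)) + cmod (exp (- (\<i> * w)))) / 2"
    using norm_triangle_ineq4[of "exp (\<i> * w)" "exp (- (\<i> * w))"]
    by (simp add: divide_right_mono del: norm_exp_eq_Re)
  also have "\<dots> = (exp (- Im w) + exp (Im w)) / 2"
    by simp
  also have "\<dots> \<le> (exp \<bar>Im w\<bar> + exp \<bar>Im w\<bar>) / 2"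
    by (intro divide_right_mono add_mono) auto
  finally show ?thesis by simp
qed

text \<open>
  For \<open>\<bar>Im w\<bar> \<le> 1\<close> this is compactness. Otherwise the reflection formula expresses \<open>rGamma w\<close> by
  \<open>sin (\<pi> w)\<close>, which accounts for the exponential, and \<open>Gamma (1 - w)\<close>. Shifting by \<open>2\<close> moves the latter
  to \<open>Gamma (3 - w)\<close>, whose argument has real part in \<open>[1, 2]\<close>, at the price of dividing by
  \<open>(1 - w) (2 - w)\<close>; the zeros of this product are the reason for excluding small \<open>\<bar>Im w\<bar>\<close>.
\<close>
lemma rGamma_strip_bound:
  obtains B where "B \<ge> 0"
    and "\<And>w. 1 \<le> Re w \<Longrightarrow> Re w \<le> 2 \<Longrightarrow> cmod (rGamma w) \<le> B * exp (pi * \<bar>Im w\<bar>)"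
proof -
  have "bounded (rGamma ` cbox (Complex 1 (-1)) (Complex 2 1))"
    by (intro compact_imp_bounded compact_continuous_image continuous_on_rGamma compact_cbox)
  then obtain B1 where B1: "\<And>w. w \<in> cbox (Complex 1 (-1)) (Complex 2 1) \<Longrightarrow> cmod (rGamma w) \<le> B1"
    unfolding bounded_iff by blast
  have "bounded ((Gamma :: real \<Rightarrow> real) ` {1..2})"
    by (intro compact_imp_bounded compact_continuous_image continuous_on_Gamma compact_Icc)
       (auto elim!: nonpos_Ints_cases)
  then obtain B2 where B2: "\<And>x::real. x \<in> {1..2} \<Longrightarrow> norm (Gamma x) \<le> B2"
    unfolding bounded_iff by blast
  have pos: "B1 \<ge> 0" "B2 \<ge> 0"
    using order.trans[OF norm_ge_zero B1[of "Complex 1 0"]] order.trans[OF norm_ge_zero B2[of 1]]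
    by (auto simp: in_cbox_complex_iff)
  have "cmod (rGamma w) \<le> (B1 + B2) * exp (pi * \<bar>Im w\<bar>)" if w: "1 \<le> Re w" "Re w \<le> 2" for w
  proof (cases "\<bar>Im w\<bar> \<le> 1")
    case True
    have "cmod (rGamma w) \<le> B1 * 1"
      using B1[of w] w True by (simp add: in_cbox_complex_iff abs_le_iff)
    also have "\<dots> \<le> (B1 + B2) * exp (pi * \<bar>Im w\<bar>)"
      using pos by (intro mult_mono) auto
    finally show ?thesis .
  next
    case False
    have "rGamma (1 - w) = (1 - w) * (2 - w) * rGamma (3 - w)"
      using pochhammer_rGamma[of "1 - w" 2] by (simp add: pochhammer_Suc numeral_2_eq_2 algebra_simps)
    moreover have "3 - w \<notin> \<int>\<^sub>\<le>\<^sub>0"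
      using w by (auto elim!: nonpos_Ints_cases simp: complex_eq_iff)
    then have "rGamma (3 - w) * Gamma (3 - w) = 1"
      by (simp add: rGamma_inverse_Gamma Gamma_eq_zero_iff)
    ultimately have eq: "rGamma w * ((1 - w) * (2 - w)) = sin (of_real pi * w) / of_real pi * Gamma (3 - w)"
      using arg_cong[OF rGamma_reflection_complex[of w], of "\<lambda>u. u * Gamma (3 - w)"]
      by (simp add: mult_ac)
    have "1 \<le> cmod (1 - w)" "1 \<le> cmod (2 - w)"
      using abs_Im_le_cmod[of "1 - w"] abs_Im_le_cmod[of "2 - w"] False by auto
    then have "1 \<le> cmod (1 - w) * cmod (2 - w)"
      using mult_mono[of 1 "cmod (1 - w)" 1 "cmod (2 - w)"] by simp
    then have "cmod (rGamma w) * 1 \<le> cmod (rGamma w) * (cmod (1 - w) * cmod (2 - w))"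
      by (intro mult_left_mono) auto
    also have "\<dots> = cmod (sin (of_real pi * w)) / pi * cmod (Gamma (3 - w))"
      using arg_cong[OF eq, of cmod] by (simp add: norm_mult norm_divide)
    also have "\<dots> \<le> exp (pi * \<bar>Im w\<bar>) * (B1 + B2)"
    proof (intro mult_mono)
      have "cmod (sin (of_real pi * w)) / pi \<le> cmod (sin (of_real pi * w)) / 1"
        using pi_ge_two by (intro divide_left_mono) auto
      also have "\<dots> \<le> exp (pi * \<bar>Im w\<bar>)"
        using norm_sin_le_exp_Im[of "of_real pi * w"] by (simp add: abs_mult)
      finally show "cmod (sin (of_real pi * w)) / pi \<le> exp (pi * \<bar>Im w\<bar>)" .
      have "cmod (Gamma (3 - w)) \<le> Gamma (3 - Re w)"
        using norm_Gamma_le_Gamma_Re[of "3 - w"] w by simp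
      then show "cmod (Gamma (3 - w)) \<le> B1 + B2"
        using B2[of "3 - Re w"] w pos by simp
    qed auto
    finally show ?thesis by (simp add: mult.commute)
  qed
  then show ?thesis using pos that[of "B1 + B2"] by auto
qed

lemma norm_pochhammer_ge_fact:
  fixes z :: complex
  assumes "Re z \<ge> 1"
  shows "fact n \<le> cmod (pochhammer z n)"
proof (induction n)
  case (Suc n)
  have "real (Suc n) \<le> cmod (z + of_nat n)"
    using complex_Re_le_cmod[of "z + of_nat n"] assms by simp
  with Suc have "real (Suc n) * fact n \<le> cmod (z + of_nat n) * cmod (pochhammer z n)"
    by (intro mult_mono) auto
  then show ?case by (simp add: pochhammer_Suc norm_mult mult.commute)
qed simp

lemma power_div_fact_le_exp:
  fixes x :: real
  assumes "x \<ge> 0"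
  shows "x ^ n / fact n \<le> exp x"
proof -
  have "sum (\<lambda>n. x ^ n /\<^sub>R fact n) {n} \<le> (\<Sum>n. x ^ n /\<^sub>R fact n)"
    using assms by (intro sum_le_suminf summable_exp_generic) auto
  then show ?thesis by (simp add: exp_def field_simps)
qed

text \<open>
  Shifting the argument to the strip \<open>1 \<le> Re w \<le> 2\<close> divides by a Pochhammer symbol with about \<open>Re z\<close>
  factors, which is at least a factorial. A factorial outgrows every exponential, so the rate \<open>s\<close> is
  at one's disposal. The factor \<open>5\<close> is a round number above \<open>\<pi> + 1\<close>, where \<open>\<pi>\<close> comes from the strip and \<open>1\<close>
  from \<open>cmod z \<le> exp (Re z + \<bar>Im z\<bar>)\<close>.
\<close>
lemma rGamma_exponential_bound:
  fixes s :: real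
  assumes "s \<ge> 0"
  obtains C where "C \<ge> 0"
    and "\<And>z. Re z > 0 \<Longrightarrow> cmod (rGamma z) \<le> C * exp (5 * \<bar>Im z\<bar> - s * Re z)"
proof -
  obtain B where B: "B \<ge> 0"
    "\<And>w. 1 \<le> Re w \<Longrightarrow> Re w \<le> 2 \<Longrightarrow> cmod (rGamma w) \<le> B * exp (pi * \<bar>Im w\<bar>)"
    by (rule rGamma_strip_bound) blast
  (* The extra unit of decay absorbs the factor z in rGamma z = z * rGamma (z + 1). *)
  define s' where "s' = s + 1"
  define C where "C = B * exp (exp s') * exp s'"
  have "cmod (rGamma z) \<le> C * exp (5 * \<bar>Im z\<bar> - s * Re z)" if z: "Re z > 0" for z
  proof -
    define n where "n = nat \<lfloor>Re z\<rfloor>"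
    (* The shift is applied to z + 1, because Re z may be close to 0 while the strip starts at 1. *)
    define w where "w = z + 1 - of_nat n"
    have n: "real n \<le> Re z" "Re z < real n + 1"
      using z by (simp_all add: n_def)
    have w: "1 \<le> Re w" "Re w \<le> 2" "Im w = Im z"
      using n by (simp_all add: w_def)
    have "rGamma w = pochhammer w n * rGamma (z + 1)"
      using pochhammer_rGamma[of w n] by (simp add: w_def)
    then have "cmod (rGamma (z + 1)) * cmod (pochhammer w n) \<le> B * exp (pi * \<bar>Im z\<bar>)"
      using B(2)[OF w(1,2)] w(3) by (simp add: norm_mult mult.commute)
    moreover have "cmod (rGamma (z + 1)) * fact n \<le> cmod (rGamma (z + 1)) * cmod (pochhammer w n)"
      using norm_pochhammer_ge_fact[OF w(1)] by (intro mult_left_mono) auto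
    ultimately have 1: "cmod (rGamma (z + 1)) \<le> B * exp (pi * \<bar>Im z\<bar>) / fact n"
      by (simp add: field_simps)
    have "1 / fact n = exp (- s' * real n) * (exp s' ^ n / fact n)"
      by (simp add: exp_of_nat_mult[symmetric] exp_minus field_simps)
    also have "\<dots> \<le> exp (s' - s' * Re z) * exp (exp s')"
    proof (intro mult_mono power_div_fact_le_exp)
      have "s' * Re z \<le> s' * (real n + 1)"
        using n assms by (intro mult_left_mono) (auto simp: s'_def)
      then show "exp (- s' * real n) \<le> exp (s' - s' * Re z)"
        by (simp add: algebra_simps)
    qed auto
    finally have "B * exp (pi * \<bar>Im z\<bar>) * (1 / fact n)
        \<le> B * exp (pi * \<bar>Im z\<bar>) * (exp (s' - s' * Re z) * exp (exp s'))"
      using B(1) by (intro mult_left_mono) auto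
    with 1 have 2: "cmod (rGamma (z + 1)) \<le> C * exp (pi * \<bar>Im z\<bar> - s' * Re z)"
      by (simp add: C_def exp_diff mult_ac)
    have "cmod z \<le> \<bar>Re z\<bar> + \<bar>Im z\<bar>"
      by (rule cmod_le)
    also have "\<dots> \<le> exp (Re z + \<bar>Im z\<bar>)"
      using z exp_ge_add_one_self[of "Re z + \<bar>Im z\<bar>"] by linarith
    finally have "cmod z * cmod (rGamma (z + 1))
        \<le> exp (Re z + \<bar>Im z\<bar>) * (C * exp (pi * \<bar>Im z\<bar> - s' * Re z))"
      using 2 by (intro mult_mono) auto
    also have "\<dots> = C * exp ((pi + 1) * \<bar>Im z\<bar> - s * Re z)"
      by (simp add: s'_def exp_add[symmetric] algebra_simps)
    also have "\<dots> \<le> C * exp (5 * \<bar>Im z\<bar> - s * Re z)"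
    proof -
      have "(pi + 1) * \<bar>Im z\<bar> \<le> 5 * \<bar>Im z\<bar>"
        using pi_less_4 by (intro mult_right_mono) auto
      then show ?thesis using B(1) by (intro mult_left_mono) (auto simp: C_def)
    qed
    finally show ?thesis
      using arg_cong[OF rGamma_plus1[of z], of cmod] by (simp add: norm_mult)
  qed
  then show ?thesis using that[of C] B(1) by (auto simp: C_def)
qed

section \<open>Geometric domination of the bounding series\<close>

lemma norm_pochhammer_le:
  fixes \<delta> :: complex
  shows "cmod (pochhammer \<delta> n) \<le> fact n * (cmod \<delta> + 1) ^ n"
proof (induction n)
  case (Suc n)
  have "cmod (\<delta> + of_nat n) \<le> cmod \<delta> + real n"
    using norm_triangle_ineq[of \<delta> "of_nat n"] by simp
  also have "\<dots> \<le> real (Suc n) * (cmod \<delta> + 1)"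
    by (simp add: algebra_simps)
  finally have "cmod (pochhammer \<delta> n) * cmod (\<delta> + of_nat n)
      \<le> (fact n * (cmod \<delta> + 1) ^ n) * (real (Suc n) * (cmod \<delta> + 1))"
    using Suc by (intro mult_mono) auto
  then show ?case by (simp add: pochhammer_Suc norm_mult mult_ac)
qed simp

text \<open>
  The quotient of factorials left over from the Pochhammer symbol is a binomial coefficient, so this
  factor of the series grows only exponentially.
\<close>
lemma norm_pochhammer_div_fact_le:
  fixes \<delta> :: complex
  shows "cmod (pochhammer \<delta> (k + l)) / (fact k * fact l) \<le> (2 * (cmod \<delta> + 1)) ^ (k + l)"
proof -
  have "cmod (pochhammer \<delta> (k + l)) / (fact k * fact l)
      \<le> fact (k + l) * (cmod \<delta> + 1) ^ (k + l) / (fact k * fact l)"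
    by (intro divide_right_mono norm_pochhammer_le) auto
  also have "\<dots> = real ((k + l) choose k) * (cmod \<delta> + 1) ^ (k + l)"
    by (simp add: binomial_fact)
  also have "\<dots> \<le> 2 ^ (k + l) * (cmod \<delta> + 1) ^ (k + l)"
  proof (intro mult_right_mono)
    show "real ((k + l) choose k) \<le> 2 ^ (k + l)"
      using of_nat_mono[OF binomial_le_pow2[of "k + l" k], where 'a = real] by simp
  qed auto
  finally show ?thesis by (simp only: power_mult_distrib)
qed

text \<open>
  With \<open>z = \<alpha> k + \<beta> l + \<gamma>\<close>, the factors other than \<open>rGamma z\<close> are bounded by a constant times \<open>H ^ (k + l) * (d - c) powr Re z\<close>.
  The part \<open>\<bar>ln (d - c)\<bar>\<close> of the decay rate \<open>s\<close> cancels the latter. With \<open>Re z \<ge> a (k + l)\<close> and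
  \<open>\<bar>Im z\<bar> \<le> b (k + l) + \<bar>Im \<gamma>\<bar>\<close>, the remaining rate \<open>t\<close> is chosen so that \<open>t a\<close> compensates the growth
  \<open>5 b\<close> from the imaginary part and leaves a factor \<open>1 / (2 H)\<close> for each unit of \<open>k + l\<close>.
\<close>
lemma ml_bound_term_geometric:
  assumes cd: "c < d" and re: "Re \<alpha> > 0" "Re \<beta> > 0" "Re \<gamma> > 0"
  obtains K where "K \<ge> 0"
    and "\<And>k l. 0 \<le> ml_bound_term c d \<alpha> \<beta> \<gamma> \<delta> \<omega>1 \<omega>2 k l"
    and "\<And>k l. ml_bound_term c d \<alpha> \<beta> \<gamma> \<delta> \<omega>1 \<omega>2 k l \<le> K * ((1/2) ^ k * (1/2) ^ l)"
proof -
  define a where "a = min (Re \<alpha>) (Re \<beta>)"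
  define b where "b = max \<bar>Im \<alpha>\<bar> \<bar>Im \<beta>\<bar>"
  define W where "W = max 1 (max (cmod \<omega>1) (cmod \<omega>2))"
  define H where "H = 2 * (cmod \<delta> + 1) * W"
  define t where "t = (5 * b + ln (2 * H)) / a"
  define s where "s = t + \<bar>ln (d - c)\<bar>"
  have a: "a > 0" and b: "b \<ge> 0" and W: "W \<ge> 1"
    using re by (auto simp: a_def b_def W_def)
  have "1 * 1 \<le> (2 * (cmod \<delta> + 1)) * W"
    using W by (intro mult_mono) auto
  then have H: "H \<ge> 1" by (simp add: H_def)
  have t: "t \<ge> 0"
    using a b H by (auto simp: t_def intro!: divide_nonneg_pos add_nonneg_nonneg)
  then have "s \<ge> 0" by (simp add: s_def)
  then obtain C where C: "C \<ge> 0"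
    "\<And>z. Re z > 0 \<Longrightarrow> cmod (rGamma z) \<le> C * exp (5 * \<bar>Im z\<bar> - s * Re z)"
    by (rule rGamma_exponential_bound) blast
  define K where "K = C * exp (5 * \<bar>Im \<gamma>\<bar>) / Re \<gamma>"
  have K: "K \<ge> 0" using C re by (simp add: K_def)
  have bound: "0 \<le> ml_bound_term c d \<alpha> \<beta> \<gamma> \<delta> \<omega>1 \<omega>2 k l \<and>
      ml_bound_term c d \<alpha> \<beta> \<gamma> \<delta> \<omega>1 \<omega>2 k l \<le> K * ((1/2) ^ k * (1/2) ^ l)" for k l
  proof -
    define z where "z = \<alpha> * of_nat k + \<beta> * of_nat l + \<gamma>"
    define n where "n = k + l"
    have Re_z: "Re z = Re \<alpha> * k + Re \<beta> * l + Re \<gamma>" and Im_z: "Im z = Im \<alpha> * k + Im \<beta> * l + Im \<gamma>"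
      by (simp_all add: z_def)
    have "a * real k + a * real l + 0 \<le> Re z"
      unfolding Re_z using re by (intro add_mono mult_right_mono) (auto simp: a_def)
    then have z1: "a * real n \<le> Re z"
      by (simp add: n_def algebra_simps)
    have z2: "Re \<gamma> \<le> Re z"
      unfolding Re_z using re by simp
    then have zpos: "Re z > 0" using re by simp
    have "\<bar>Im z\<bar> \<le> \<bar>Im \<alpha> * k\<bar> + \<bar>Im \<beta> * l\<bar> + \<bar>Im \<gamma>\<bar>"
      unfolding Im_z by linarith
    also have "\<dots> \<le> b * real k + b * real l + \<bar>Im \<gamma>\<bar>"
      unfolding abs_mult by (intro add_mono mult_mono) (auto simp: b_def)
    finally have z3: "\<bar>Im z\<bar> \<le> b * real n + \<bar>Im \<gamma>\<bar>"
      by (simp add: n_def algebra_simps)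
    have eq: "ml_bound_term c d \<alpha> \<beta> \<gamma> \<delta> \<omega>1 \<omega>2 k l =
        (cmod (pochhammer \<delta> (k + l)) / (fact k * fact l)) * (cmod \<omega>1 ^ k * cmod \<omega>2 ^ l)
          * (1 / Re z * (cmod (rGamma z) * (d - c) powr Re z))"
      unfolding ml_bound_term_def z_def[symmetric]
      by (simp add: rGamma_inverse_Gamma norm_inverse divide_inverse mult_ac)
    have A1: "cmod (pochhammer \<delta> (k + l)) / (fact k * fact l) \<le> (2 * (cmod \<delta> + 1)) ^ n"
      unfolding n_def by (rule norm_pochhammer_div_fact_le)
    have A2: "cmod \<omega>1 ^ k * cmod \<omega>2 ^ l \<le> W ^ n"
      unfolding n_def power_add by (intro mult_mono power_mono) (auto simp: W_def)
    have A3: "cmod (rGamma z) * (d - c) powr Re z \<le> C * exp (5 * \<bar>Im \<gamma>\<bar>) * (1 / (2 * H)) ^ n"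
    proof -
      have "cmod (rGamma z) * (d - c) powr Re z
          \<le> C * exp (5 * \<bar>Im z\<bar> - s * Re z) * exp (Re z * \<bar>ln (d - c)\<bar>)"
        using C zpos cd by (intro mult_mono) (auto simp: powr_def intro!: mult_left_mono)
      also have "\<dots> = C * exp (5 * \<bar>Im z\<bar> - t * Re z)"
        by (simp add: s_def exp_add[symmetric] algebra_simps)
      also have "\<dots> \<le> C * exp (5 * (b * real n + \<bar>Im \<gamma>\<bar>) - t * (a * real n))"
        using C z3 mult_left_mono[OF z1 t] by (intro mult_left_mono) auto
      also have "5 * (b * real n + \<bar>Im \<gamma>\<bar>) - t * (a * real n) = 5 * \<bar>Im \<gamma>\<bar> + real n * (- ln (2 * H))"
      proof -
        have "t * a = 5 * b + ln (2 * H)" using a by (simp add: t_def)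
        then have "t * (a * real n) = (5 * b + ln (2 * H)) * real n" by (simp add: mult.assoc[symmetric])
        then show ?thesis by (simp add: algebra_simps)
      qed
      also have "C * exp (5 * \<bar>Im \<gamma>\<bar> + real n * (- ln (2 * H)))
          = C * exp (5 * \<bar>Im \<gamma>\<bar>) * (1 / (2 * H)) ^ n"
        using H unfolding exp_add exp_of_nat_mult exp_minus
        by (simp add: inverse_eq_divide mult.assoc)
      finally show ?thesis .
    qed
    have A4: "1 / Re z \<le> 1 / Re \<gamma>"
      using z2 re by (intro divide_left_mono) auto
    have "ml_bound_term c d \<alpha> \<beta> \<gamma> \<delta> \<omega>1 \<omega>2 k l \<le>
        ((2 * (cmod \<delta> + 1)) ^ n * W ^ n) * (1 / Re \<gamma> * (C * exp (5 * \<bar>Im \<gamma>\<bar>) * (1 / (2 * H)) ^ n))"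
      unfolding eq
      by (rule mult_mono[OF mult_mono[OF A1 A2] mult_mono[OF A4 A3]])
        (use re zpos W in \<open>auto intro!: mult_nonneg_nonneg\<close>)
    also have "\<dots> = K * (H * (1 / (2 * H))) ^ n"
      unfolding power_mult_distrib H_def K_def by (simp add: mult_ac)
    also have "\<dots> = K * ((1/2) ^ k * (1/2) ^ l)"
      using H by (simp add: n_def power_add)
    finally show ?thesis
      unfolding eq using zpos by simp
  qed
  then show ?thesis using that[of K] K by blast
qed

lemma summable_on_geometric_product:
  "(\<lambda>(k, l). (1/2 :: real) ^ k * (1/2) ^ l) summable_on (UNIV :: (nat \<times> nat) set)"
proof -
  have hs: "((\<lambda>l. (1/2 :: real) ^ l) has_sum 2) UNIV"
    by (rule norm_summable_imp_has_sum) (use geometric_sums[of "1/2 :: real"] in \<open>auto simp: summable_geometric\<close>)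
  have "(\<lambda>(k, l). (1/2 :: real) ^ k * (1/2) ^ l) summable_on (SIGMA k:UNIV. (UNIV :: nat set))"
  proof (rule summable_on_SigmaI)
    show "((\<lambda>l. case (k, l) of (k, l) \<Rightarrow> (1/2 :: real) ^ k * (1/2) ^ l) has_sum ((1/2) ^ k * 2)) UNIV" for k :: nat
      using has_sum_cmult_right[OF hs] by simp
    show "(\<lambda>k. (1/2 :: real) ^ k * 2) summable_on UNIV"
      using hs by (intro summable_on_cmult_left) (auto simp: summable_on_def)
  qed auto
  then show ?thesis by simp
qed

lemma ml_bound_term_summable_on:
  assumes "c < d" "Re \<alpha> > 0" "Re \<beta> > 0" "Re \<gamma> > 0"
  shows "(\<lambda>(k, l). ml_bound_term c d \<alpha> \<beta> \<gamma> \<delta> \<omega>1 \<omega>2 k l) summable_on UNIV"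
proof -
  obtain K where "\<And>k l. 0 \<le> ml_bound_term c d \<alpha> \<beta> \<gamma> \<delta> \<omega>1 \<omega>2 k l"
    and "\<And>k l. ml_bound_term c d \<alpha> \<beta> \<gamma> \<delta> \<omega>1 \<omega>2 k l \<le> K * ((1/2) ^ k * (1/2) ^ l)"
    using ml_bound_term_geometric[OF assms] by metis
  then show ?thesis
    by (intro summable_on_comparison_test[OF
          summable_on_cmult_right[OF summable_on_geometric_product, of K]]) auto
qed

text \<open>
  The iterated sums of reals default to arbitrary values unless every row and the series of row sums
  converge. The geometric domination gives both, so the sums agree with those in the extended
  nonnegative reals, where the integral of the kernel is estimated.
\<close>
lemma ennreal_ml_bound:
  assumes "c < d" "Re \<alpha> > 0" "Re \<beta> > 0" "Re \<gamma> > 0"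
  shows "ennreal (ml_bound c d \<alpha> \<beta> \<gamma> \<delta> \<omega>1 \<omega>2)
       = (\<Sum>k. \<Sum>l. ennreal (ml_bound_term c d \<alpha> \<beta> \<gamma> \<delta> \<omega>1 \<omega>2 k l))"
    and "ml_bound c d \<alpha> \<beta> \<gamma> \<delta> \<omega>1 \<omega>2 \<ge> 0"
proof -
  let ?u = "ml_bound_term c d \<alpha> \<beta> \<gamma> \<delta> \<omega>1 \<omega>2"
  obtain K where nonneg: "\<And>k l. 0 \<le> ?u k l"
    and le: "\<And>k l. ?u k l \<le> K * ((1/2) ^ k * (1/2) ^ l)"
    using ml_bound_term_geometric[OF assms] by metis
  have geo: "(\<lambda>l. (1/2 :: real) ^ l) sums 2"
    using geometric_sums[of "1/2 :: real"] by simp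
  have row: "summable (?u k)" for k
  proof (rule summable_comparison_test')
    show "summable (\<lambda>l. K * (1/2) ^ k * (1/2) ^ l)"
      using geo by (intro summable_mult) (auto simp: sums_iff)
    show "norm (?u k l) \<le> K * (1/2) ^ k * (1/2) ^ l" if "l \<ge> 0" for l
      using nonneg[of k l] le[of k l] by (simp add: mult.assoc)
  qed
  have row_nonneg: "0 \<le> (\<Sum>l. ?u k l)" for k
    by (intro suminf_nonneg row nonneg)
  have rows: "summable (\<lambda>k. \<Sum>l. ?u k l)"
  proof (rule summable_comparison_test')
    show "summable (\<lambda>k. K * (1/2) ^ k * 2)"
      using geo by (intro summable_mult2 summable_mult) (auto simp: sums_iff)
    have "(\<Sum>l. ?u k l) \<le> (\<Sum>l. K * (1/2) ^ k * (1/2) ^ l)" for k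
      using le geo by (intro suminf_le row summable_mult) (auto simp: mult.assoc sums_iff)
    also have "(\<Sum>l. K * (1/2) ^ k * (1/2) ^ l) = K * (1/2) ^ k * 2" for k
      using sums_mult[OF geo, of "K * (1/2) ^ k"] by (simp add: sums_iff)
    finally show "norm (\<Sum>l. ?u k l) \<le> K * (1/2) ^ k * 2" for k
      using row_nonneg by simp
  qed
  show "ennreal (ml_bound c d \<alpha> \<beta> \<gamma> \<delta> \<omega>1 \<omega>2) = (\<Sum>k. \<Sum>l. ennreal (?u k l))"
    unfolding ml_bound_def by (simp add: suminf_ennreal2 nonneg row row_nonneg rows)
  show "ml_bound c d \<alpha> \<beta> \<gamma> \<delta> \<omega>1 \<omega>2 \<ge> 0"
    unfolding ml_bound_def by (intro suminf_nonneg rows row_nonneg)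
qed

section \<open>The integral norm of the kernel\<close>

text \<open>
  If the series is not absolutely summable, the right-hand side is infinite; this is what allows the
  kernel to be estimated before its convergence is discussed.
\<close>
lemma ennreal_norm_suminf_le:
  fixes u :: "nat \<Rightarrow> complex"
  shows "ennreal (cmod (\<Sum>n. u n)) \<le> (\<Sum>n. ennreal (cmod (u n)))"
proof (cases "(\<Sum>n. ennreal (cmod (u n))) = top")
  case False
  then have sm: "summable (\<lambda>n. cmod (u n))"
    by (intro summable_suminf_not_top) auto
  then show ?thesis
    using summable_norm[OF sm] by (simp add: suminf_ennreal2 ennreal_leI)
qed simp

lemma nn_integral_powr_le:
  fixes r T :: real
  assumes "r > 0" "T > 0"
  shows "(\<integral>\<^sup>+ t. ennreal (indicator {0<..<T} t * t powr (r - 1)) \<partial>lborel) \<le> ennreal (T powr r / r)"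
proof -
  have "((\<lambda>t. t powr (r - 1)) has_integral (T powr (r - 1 + 1) / (r - 1 + 1))) {0..T}"
    by (rule has_integral_powr_from_0) (use assms in auto)
  then have "(\<integral>\<^sup>+ t. ennreal (indicator {0..T} t * t powr (r - 1)) \<partial>lborel) = ennreal (T powr r / r)"
    using nn_integral_has_integral_lebesgue[of "{0..T}" "\<lambda>t. t powr (r - 1)"] by simp
  moreover have "(\<integral>\<^sup>+ t. ennreal (indicator {0<..<T} t * t powr (r - 1)) \<partial>lborel)
      \<le> (\<integral>\<^sup>+ t. ennreal (indicator {0..T} t * t powr (r - 1)) \<partial>lborel)"
    by (intro nn_integral_mono ennreal_leI mult_right_mono) (auto simp: indicator_def)
  ultimately show ?thesis by simp
qed

lemma borel_measurable_of_real_powr: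
  fixes a :: complex
  shows "(\<lambda>t. indicator {0<..} t *\<^sub>R complex_of_real t powr a) \<in> borel_measurable borel"
  by (rule borel_measurable_continuous_on_indicator)
     (auto intro!: continuous_intros simp: complex_nonpos_Reals_iff)

text \<open>
  Continuity of complex powers holds off the nonpositive half-line, so they are first cut off to
  \<open>t > 0\<close>. The kernel is then built from measurable functions by products and limits of series.
\<close>
lemma borel_measurable_ml_kernel:
  "(\<lambda>t. indicator {0<..<T} t *\<^sub>R ml_kernel \<alpha> \<beta> \<gamma> \<delta> \<omega>1 \<omega>2 t) \<in> borel_measurable borel"
proof -
  define p where "p = (\<lambda>a t. indicator {0<..} t *\<^sub>R complex_of_real t powr a)"
  have [measurable]: "p a \<in> borel_measurable borel" for a
    unfolding p_def by (rule borel_measurable_of_real_powr)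
  have "(\<lambda>t. indicator {0<..<T} t *\<^sub>R ml_kernel \<alpha> \<beta> \<gamma> \<delta> \<omega>1 \<omega>2 t)
      = (\<lambda>t. indicator {0<..<T} t *\<^sub>R
           (p (\<gamma> - 1) t * mittag_leffler2 \<alpha> \<beta> \<gamma> \<delta> (\<omega>1 * p \<alpha> t) (\<omega>2 * p \<beta> t)))"
    by (auto simp: fun_eq_iff ml_kernel_def p_def indicator_def)
  also have "\<dots> \<in> borel_measurable borel"
    unfolding mittag_leffler2_def by measurable
  finally show ?thesis .
qed

text \<open>
  The complex powers combine in absolute value to \<open>t powr (Re z - 1)\<close>. The coefficient is written as a
  term of the bounding series divided by \<open>(d - c) powr Re z / Re z\<close>, so that integrating the power over
  \<open>(0, d - c)\<close> returns the term itself.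
\<close>
lemma ml_kernel_pointwise_bound:
  assumes cd: "c < d" and re: "Re \<alpha> > 0" "Re \<beta> > 0" "Re \<gamma> > 0" and t: "t > 0"
  defines "z k l \<equiv> \<alpha> * of_nat k + \<beta> * of_nat l + \<gamma>"
  shows "ennreal (cmod (ml_kernel \<alpha> \<beta> \<gamma> \<delta> \<omega>1 \<omega>2 t))
     \<le> (\<Sum>k. \<Sum>l. ennreal (ml_bound_term c d \<alpha> \<beta> \<gamma> \<delta> \<omega>1 \<omega>2 k l
            * (Re (z k l) / (d - c) powr Re (z k l)) * t powr (Re (z k l) - 1)))"
proof -
  define u where "u k l = pochhammer \<delta> (k + l) / Gamma (z k l)
      * ((\<omega>1 * complex_of_real t powr \<alpha>) ^ k * (\<omega>2 * complex_of_real t powr \<beta>) ^ l / (fact k * fact l))"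
    for k l
  have Re_z: "Re (z k l) = Re \<alpha> * k + Re \<beta> * l + Re \<gamma>" for k l
    by (simp add: z_def)
  have zpos: "Re (z k l) > 0" for k l
    using re by (simp add: Re_z add_nonneg_pos)
  have term_eq: "t powr (Re \<gamma> - 1) * cmod (u k l) = ml_bound_term c d \<alpha> \<beta> \<gamma> \<delta> \<omega>1 \<omega>2 k l
            * (Re (z k l) / (d - c) powr Re (z k l)) * t powr (Re (z k l) - 1)" for k l
  proof -
    have "t powr (Re (z k l) - 1) = t powr (Re \<gamma> - 1) * (t powr Re \<alpha>) ^ k * (t powr Re \<beta>) ^ l"
      using t by (simp add: Re_z powr_add[symmetric] powr_power algebra_simps)
    then show ?thesis
      using t zpos[of k l] cd
      by (simp add: u_def ml_bound_term_def z_def[symmetric] norm_mult norm_divide norm_power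
          norm_powr_real_powr power_mult_distrib)
  qed
  have "ennreal (cmod (ml_kernel \<alpha> \<beta> \<gamma> \<delta> \<omega>1 \<omega>2 t))
      = ennreal (t powr (Re \<gamma> - 1)) * ennreal (cmod (\<Sum>k. \<Sum>l. u k l))"
    using t by (simp add: ml_kernel_def mittag_leffler2_def u_def z_def norm_mult
        norm_powr_real_powr ennreal_mult)
  also have "\<dots> \<le> ennreal (t powr (Re \<gamma> - 1)) * (\<Sum>k. \<Sum>l. ennreal (cmod (u k l)))"
    by (intro mult_left_mono order.trans[OF ennreal_norm_suminf_le] suminf_le ennreal_norm_suminf_le) auto
  also have "\<dots> = (\<Sum>k. \<Sum>l. ennreal (t powr (Re \<gamma> - 1) * cmod (u k l)))"
    by (simp add: ennreal_mult)
  finally show ?thesis unfolding term_eq .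
qed

lemma nn_integral_ml_kernel_le:
  assumes cd: "c < d" and re: "Re \<alpha> > 0" "Re \<beta> > 0" "Re \<gamma> > 0"
  shows "(\<integral>\<^sup>+ t. ennreal (cmod (indicator {0<..<d - c} t *\<^sub>R ml_kernel \<alpha> \<beta> \<gamma> \<delta> \<omega>1 \<omega>2 t)) \<partial>lborel)
     \<le> ennreal (ml_bound c d \<alpha> \<beta> \<gamma> \<delta> \<omega>1 \<omega>2)"
proof -
  define r where "r k l = Re (\<alpha> * of_nat k + \<beta> * of_nat l + \<gamma>)" for k l
  define b where "b k l = ml_bound_term c d \<alpha> \<beta> \<gamma> \<delta> \<omega>1 \<omega>2 k l" for k l
  define p :: "nat \<Rightarrow> nat \<Rightarrow> real \<Rightarrow> real"
    where "p k l t = indicator {0<..<d - c} t * t powr (r k l - 1)" for k l t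
  have r: "r k l > 0" for k l
    using re by (simp add: r_def add_nonneg_pos)
  have b: "b k l \<ge> 0" for k l
    using ml_bound_term_geometric[OF assms] unfolding b_def by metis
  have p: "p k l t \<ge> 0" for k l t
    by (simp add: p_def)
  have [measurable]: "p k l \<in> borel_measurable borel" for k l
    unfolding p_def by measurable
  have pow: "(d - c) powr r k l > 0" for k l
    using cd by simp
  have "(\<integral>\<^sup>+ t. ennreal (cmod (indicator {0<..<d - c} t *\<^sub>R ml_kernel \<alpha> \<beta> \<gamma> \<delta> \<omega>1 \<omega>2 t)) \<partial>lborel)
      \<le> (\<integral>\<^sup>+ t. (\<Sum>k. \<Sum>l. ennreal (b k l * (r k l / (d - c) powr r k l)) * ennreal (p k l t)) \<partial>lborel)"
  proof (rule nn_integral_mono)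
    fix t :: real
    show "ennreal (cmod (indicator {0<..<d - c} t *\<^sub>R ml_kernel \<alpha> \<beta> \<gamma> \<delta> \<omega>1 \<omega>2 t))
        \<le> (\<Sum>k. \<Sum>l. ennreal (b k l * (r k l / (d - c) powr r k l)) * ennreal (p k l t))"
    proof (cases "t \<in> {0<..<d - c}")
      case True
      have eq: "ennreal (b k l * (r k l / (d - c) powr r k l)) * ennreal (p k l t)
          = ennreal (b k l * (r k l / (d - c) powr r k l) * t powr (r k l - 1))" for k l
        using True b[of k l] r[of k l] by (simp add: p_def flip: ennreal_mult)
      show ?thesis
        unfolding eq using ml_kernel_pointwise_bound[OF assms, of t] True
        by (simp add: b_def r_def)
    qed simp
  qed
  also have "\<dots> = (\<Sum>k. \<Sum>l. ennreal (b k l * (r k l / (d - c) powr r k l)) * (\<integral>\<^sup>+ t. ennreal (p k l t) \<partial>lborel))"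
    by (simp add: nn_integral_suminf nn_integral_cmult)
  also have "\<dots> \<le> (\<Sum>k. \<Sum>l. ennreal (b k l))"
  proof (intro suminf_le)
    fix k l
    have "ennreal (b k l * (r k l / (d - c) powr r k l)) * (\<integral>\<^sup>+ t. ennreal (p k l t) \<partial>lborel)
        \<le> ennreal (b k l * (r k l / (d - c) powr r k l)) * ennreal ((d - c) powr r k l / r k l)"
      unfolding p_def using r cd by (intro mult_left_mono nn_integral_powr_le) auto
    also have "\<dots> = ennreal (b k l)"
      using b[of k l] r[of k l] pow[of k l] cd by (simp flip: ennreal_mult)
    finally show "ennreal (b k l * (r k l / (d - c) powr r k l)) * (\<integral>\<^sup>+ t. ennreal (p k l t) \<partial>lborel)
        \<le> ennreal (b k l)" .
  qed auto
  also have "\<dots> = ennreal (ml_bound c d \<alpha> \<beta> \<gamma> \<delta> \<omega>1 \<omega>2)"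
    unfolding b_def by (rule ennreal_ml_bound(1)[OF assms, symmetric])
  finally show ?thesis .
qed

lemma truncated_ml_kernel_L1:
  fixes c d :: real and \<alpha> \<beta> \<gamma> \<delta> \<omega>1 \<omega>2 :: complex
  assumes "c < d" "Re \<alpha> > 0" "Re \<beta> > 0" "Re \<gamma> > 0"
  defines "K \<equiv> \<lambda>t. indicator {0<..<d - c} t *\<^sub>R ml_kernel \<alpha> \<beta> \<gamma> \<delta> \<omega>1 \<omega>2 t"
  shows "integrable lborel K" and "(LINT t|lborel. cmod (K t)) \<le> ml_bound c d \<alpha> \<beta> \<gamma> \<delta> \<omega>1 \<omega>2"
proof -
  have meas: "K \<in> borel_measurable lborel"
    unfolding K_def by (simp add: borel_measurable_ml_kernel)
  have le: "(\<integral>\<^sup>+ t. ennreal (cmod (K t)) \<partial>lborel) \<le> ennreal (ml_bound c d \<alpha> \<beta> \<gamma> \<delta> \<omega>1 \<omega>2)"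
    unfolding K_def by (rule nn_integral_ml_kernel_le) fact+
  show int: "integrable lborel K"
    using meas le_less_trans[OF le ennreal_less_top] by (intro integrableI_bounded) simp_all
  have "ennreal (LINT t|lborel. cmod (K t)) \<le> ennreal (ml_bound c d \<alpha> \<beta> \<gamma> \<delta> \<omega>1 \<omega>2)"
    using le nn_integral_eq_integral[OF integrable_norm[OF int]] by simp
  then show "(LINT t|lborel. cmod (K t)) \<le> ml_bound c d \<alpha> \<beta> \<gamma> \<delta> \<omega>1 \<omega>2"
    using ennreal_ml_bound(2)[OF assms(1-4)] by (simp add: ennreal_le_iff)
qed

section \<open>Convolution of integrable functions\<close>

text \<open>
  This is Fubini's theorem for \<open>K (x - y) * F y\<close>: integrating the absolute value over \<open>x\<close> first gives the
  norm of \<open>K\<close> by translation invariance, whatever \<open>y\<close> is.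
\<close>
lemma borel_convolution_integrable:
  fixes K F :: "real \<Rightarrow> complex"
  assumes K: "integrable lborel K" and F: "integrable lborel F"
  shows "AE x in lborel. integrable lborel (\<lambda>y. K (x - y) * F y)"
    and "integrable lborel (\<lambda>x. LINT y|lborel. K (x - y) * F y)"
    and "(LINT x|lborel. cmod (LINT y|lborel. K (x - y) * F y))
        \<le> (LINT t|lborel. cmod (K t)) * (LINT y|lborel. cmod (F y))"
proof -
  have [measurable]: "K \<in> borel_measurable borel" "F \<in> borel_measurable borel"
    using K F by (auto dest: borel_measurable_integrable)
  have shift: "integrable lborel (\<lambda>x. K (x - y))" for y
    using lborel_integrable_real_affine[OF K, of 1 "- y"] by simp
  have norm_shift: "(LINT x|lborel. cmod (K (x - y))) = (LINT t|lborel. cmod (K t))" for y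
    using lborel_integral_real_affine[of 1 "\<lambda>t. cmod (K t)" "- y"] by simp
  have inner: "(LINT x|lborel. cmod (K (x - y) * F y)) = (LINT t|lborel. cmod (K t)) * cmod (F y)" for y
    by (simp add: norm_mult norm_shift)
  have int: "integrable (lborel \<Otimes>\<^sub>M lborel) (\<lambda>(y, x). K (x - y) * F y)"
  proof (rule lborel_pair.Fubini_integrable)
    show "integrable lborel (\<lambda>y. LINT x|lborel. cmod (case (y, x) of (y, x) \<Rightarrow> K (x - y) * F y))"
      using F by (simp add: inner)
    show "AE y in lborel. integrable lborel (\<lambda>x. case (y, x) of (y, x) \<Rightarrow> K (x - y) * F y)"
      using shift by simp
  qed simp
  then have intn: "integrable (lborel \<Otimes>\<^sub>M lborel) (\<lambda>(y, x). cmod (K (x - y) * F y))"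
    using integrable_norm[OF int] by (simp add: case_prod_beta')
  show "AE x in lborel. integrable lborel (\<lambda>y. K (x - y) * F y)"
    by (rule lborel_pair.AE_integrable_snd[OF int])
  show conv: "integrable lborel (\<lambda>x. LINT y|lborel. K (x - y) * F y)"
    by (rule lborel_pair.integrable_snd[OF int])
  have "(LINT x|lborel. cmod (LINT y|lborel. K (x - y) * F y))
      \<le> (LINT x|lborel. LINT y|lborel. cmod (K (x - y) * F y))"
    by (intro integral_mono integrable_norm conv lborel_pair.integrable_snd[OF intn] integral_norm_bound)
  also have "\<dots> = (LINT y|lborel. LINT x|lborel. cmod (K (x - y) * F y))"
    by (rule lborel_pair.Fubini_integral[OF intn])
  also have "\<dots> = (LINT t|lborel. cmod (K t)) * (LINT y|lborel. cmod (F y))"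
    unfolding inner by simp
  finally show "(LINT x|lborel. cmod (LINT y|lborel. K (x - y) * F y))
        \<le> (LINT t|lborel. cmod (K t)) * (LINT y|lborel. cmod (F y))" .
qed

text \<open>
  Fubini's theorem is applied to the product of two copies of the Borel measure, whereas elements of
  \<open>L\<^sup>1\<close> are only Lebesgue measurable. Borel representatives of the real and imaginary parts bridge this
  gap.
\<close>
lemma integrable_lebesgue_borel_representative:
  fixes f :: "real \<Rightarrow> complex"
  assumes f: "integrable lebesgue f"
  obtains F where "integrable lborel F" "AE x in lebesgue. f x = F x"
proof -
  have [measurable]: "f \<in> borel_measurable lebesgue"
    using f by (rule borel_measurable_integrable)
  obtain g h where gh: "g \<in> borel_measurable lborel" "h \<in> borel_measurable lborel"
    "AE x in lborel. Re (f x) = g x" "AE x in lborel. Im (f x) = h x"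
    using completion_ex_borel_measurable_real[of "\<lambda>x. Re (f x)" lborel]
      completion_ex_borel_measurable_real[of "\<lambda>x. Im (f x)" lborel] by auto
  define F where "F = (\<lambda>x. complex_of_real (g x) + \<i> * complex_of_real (h x))"
  have F[measurable]: "F \<in> borel_measurable lborel"
    using gh(1,2) unfolding F_def by measurable
  have FL: "F \<in> borel_measurable lebesgue"
    using F by (rule measurable_completion)
  have "AE x in lborel. f x = F x"
    using gh(3,4) by eventually_elim (auto simp: F_def complex_eq_iff)
  then have ae: "AE x in lebesgue. f x = F x"
    by (rule AE_completion)
  then have "integrable lebesgue F"
    using f FL by (subst integrable_cong_AE[of _ _ f]) auto
  then have "integrable lborel F"
    using F by (simp add: integrable_completion)
  with ae that show ?thesis by blast
qed

text \<open>
  For every \<open>x\<close>, not just almost every \<open>x\<close>, the convolution integral is unchanged when \<open>f\<close> is replaced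
  by a Borel representative, because the integrands differ only on a null set of \<open>y\<close>.
\<close>
lemma convolution_integrable:
  fixes K f :: "real \<Rightarrow> complex"
  assumes K: "integrable lborel K" and f: "integrable lebesgue f"
  shows "AE x in lebesgue. integrable lebesgue (\<lambda>y. K (x - y) * f y)"
    and "integrable lebesgue (\<lambda>x. LINT y|lebesgue. K (x - y) * f y)"
    and "(LINT x|lebesgue. cmod (LINT y|lebesgue. K (x - y) * f y))
        \<le> (LINT t|lborel. cmod (K t)) * (LINT y|lebesgue. cmod (f y))"
proof -
  obtain F where F: "integrable lborel F" and ae: "AE x in lebesgue. f x = F x"
    using integrable_lebesgue_borel_representative[OF f] .
  have [measurable]: "K \<in> borel_measurable borel" "F \<in> borel_measurable borel"
    using K F by (auto dest: borel_measurable_integrable)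
  have [measurable]: "f \<in> borel_measurable lebesgue"
    using f by (rule borel_measurable_integrable)
  have borel: "(\<lambda>y. K (x - y) * F y) \<in> borel_measurable lborel" for x
    by measurable
  have KL[measurable]: "(\<lambda>y. K (x - y)) \<in> borel_measurable lebesgue" for x
    by (rule measurable_completion) simp
  have FL[measurable]: "F \<in> borel_measurable lebesgue"
    by (rule measurable_completion) simp
  have ae': "AE y in lebesgue. K (x - y) * f y = K (x - y) * F y" for x
    using ae by eventually_elim simp
  have int_iff: "integrable lebesgue (\<lambda>y. K (x - y) * f y) \<longleftrightarrow> integrable lborel (\<lambda>y. K (x - y) * F y)" for x
    using integrable_cong_AE[OF _ _ ae'[of x]] integrable_completion[OF borel[of x]] by simp
  have lint: "(LINT y|lebesgue. K (x - y) * f y) = (LINT y|lborel. K (x - y) * F y)" for x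
    using integral_cong_AE[OF _ _ ae'[of x]] integral_completion[OF borel[of x]] by simp
  have lintn: "(LINT y|lebesgue. cmod (f y)) = (LINT y|lborel. cmod (F y))"
  proof -
    have "(LINT y|lebesgue. cmod (f y)) = (LINT y|lebesgue. cmod (F y))"
      using ae by (intro integral_cong_AE) auto
    then show ?thesis by (simp add: integral_completion)
  qed
  note Y = borel_convolution_integrable[OF K F]
  have meas: "(\<lambda>x. LINT y|lborel. K (x - y) * F y) \<in> borel_measurable lborel"
    using Y(2) by (rule borel_measurable_integrable)
  show "AE x in lebesgue. integrable lebesgue (\<lambda>y. K (x - y) * f y)"
    unfolding int_iff using Y(1) by (rule AE_completion)
  show "integrable lebesgue (\<lambda>x. LINT y|lebesgue. K (x - y) * f y)"
    unfolding lint using Y(2) meas by (simp add: integrable_completion)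
  show "(LINT x|lebesgue. cmod (LINT y|lebesgue. K (x - y) * f y))
        \<le> (LINT t|lborel. cmod (K t)) * (LINT y|lebesgue. cmod (f y))"
    unfolding lint lintn using Y(3) meas by (simp add: integral_completion)
qed

section \<open>Boundedness and linearity of the operator\<close>

text \<open>
  Young's inequality is applied to the truncated kernel and the extension of \<open>f\<close> by zero; their
  convolution agrees on \<open>(c, d)\<close> with the operator because the two cut-offs together leave exactly the
  window \<open>c < \<xi> < x\<close>.
\<close>
lemma ml_integral_L1:
  assumes cd: "c < d" and re: "Re \<alpha> > 0" "Re \<beta> > 0" "Re \<gamma> > 0"
    and f: "f absolutely_integrable_on {c<..<d}"
  shows "AE x in lebesgue. x \<in> {c<..<d} \<longrightarrow>
          (\<lambda>\<xi>. ml_kernel \<alpha> \<beta> \<gamma> \<delta> \<omega>1 \<omega>2 (x - \<xi>) * f \<xi>) absolutely_integrable_on {c<..<x}"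
    and "ml_integral c \<alpha> \<beta> \<gamma> \<delta> \<omega>1 \<omega>2 f absolutely_integrable_on {c<..<d}"
    and "L1_norm c d (ml_integral c \<alpha> \<beta> \<gamma> \<delta> \<omega>1 \<omega>2 f)
         \<le> ml_bound c d \<alpha> \<beta> \<gamma> \<delta> \<omega>1 \<omega>2 * L1_norm c d f"
proof -
  define K where "K = (\<lambda>t. indicator {0<..<d - c} t *\<^sub>R ml_kernel \<alpha> \<beta> \<gamma> \<delta> \<omega>1 \<omega>2 t)"
  define \<phi> where "\<phi> = (\<lambda>\<xi>. indicator {c<..<d} \<xi> *\<^sub>R f \<xi>)"
  define C where "C = (\<lambda>x. LINT \<xi>|lebesgue. K (x - \<xi>) * \<phi> \<xi>)"
  have K: "integrable lborel K" "(LINT t|lborel. cmod (K t)) \<le> ml_bound c d \<alpha> \<beta> \<gamma> \<delta> \<omega>1 \<omega>2"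
    unfolding K_def by (rule truncated_ml_kernel_L1[OF cd re])+
  have \<phi>: "integrable lebesgue \<phi>"
    using f by (simp add: \<phi>_def set_integrable_def)
  note conv = convolution_integrable[OF K(1) \<phi>]
  have C: "integrable lebesgue C"
    unfolding C_def by (rule conv(2))
  have window: "indicator {c<..<x} \<xi> *\<^sub>R (ml_kernel \<alpha> \<beta> \<gamma> \<delta> \<omega>1 \<omega>2 (x - \<xi>) * f \<xi>) = K (x - \<xi>) * \<phi> \<xi>"
    if "x \<in> {c<..<d}" for x \<xi>
    using that by (auto simp: K_def \<phi>_def indicator_def)
  have eq: "ml_integral c \<alpha> \<beta> \<gamma> \<delta> \<omega>1 \<omega>2 f x = C x" if "x \<in> {c<..<d}" for x
    unfolding ml_integral_def set_lebesgue_integral_def window[OF that] C_def ..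
  show "AE x in lebesgue. x \<in> {c<..<d} \<longrightarrow>
          (\<lambda>\<xi>. ml_kernel \<alpha> \<beta> \<gamma> \<delta> \<omega>1 \<omega>2 (x - \<xi>) * f \<xi>) absolutely_integrable_on {c<..<x}"
    using conv(1) by eventually_elim (simp add: set_integrable_def window)
  have "set_integrable lebesgue {c<..<d} C"
    unfolding set_integrable_def by (rule integrable_mult_indicator[OF _ C]) simp
  then show "ml_integral c \<alpha> \<beta> \<gamma> \<delta> \<omega>1 \<omega>2 f absolutely_integrable_on {c<..<d}"
    by (rule set_integrable_cong[THEN iffD1, rotated -1]) (simp_all add: eq)
  have norm\<phi>: "L1_norm c d f = (LINT \<xi>|lebesgue. cmod (\<phi> \<xi>))"
    by (simp add: L1_norm_def set_lebesgue_integral_def \<phi>_def)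
  have "L1_norm c d (ml_integral c \<alpha> \<beta> \<gamma> \<delta> \<omega>1 \<omega>2 f) = (LINT x|lebesgue. indicator {c<..<d} x *\<^sub>R cmod (C x))"
    unfolding L1_norm_def set_lebesgue_integral_def
    by (intro Bochner_Integration.integral_cong) (auto simp: indicator_def eq)
  also have "\<dots> \<le> (LINT x|lebesgue. cmod (C x))"
    using C by (intro integral_mono integrable_mult_indicator integrable_norm)
      (auto simp: indicator_def)
  also have "\<dots> \<le> (LINT t|lborel. cmod (K t)) * L1_norm c d f"
    unfolding norm\<phi> C_def by (rule conv(3))
  also have "\<dots> \<le> ml_bound c d \<alpha> \<beta> \<gamma> \<delta> \<omega>1 \<omega>2 * L1_norm c d f"
    using K(2) by (rule mult_right_mono) (simp add: norm\<phi>)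
  finally show "L1_norm c d (ml_integral c \<alpha> \<beta> \<gamma> \<delta> \<omega>1 \<omega>2 f)
         \<le> ml_bound c d \<alpha> \<beta> \<gamma> \<delta> \<omega>1 \<omega>2 * L1_norm c d f" .
qed

text \<open>
  Additivity of the Bochner integral needs both integrands to be integrable, which holds for almost
  every \<open>x\<close>.
\<close>
lemma ml_integral_linear:
  assumes cd: "c < d" and re: "Re \<alpha> > 0" "Re \<beta> > 0" "Re \<gamma> > 0"
    and f: "f absolutely_integrable_on {c<..<d}" and g: "g absolutely_integrable_on {c<..<d}"
  shows "AE x in lebesgue. x \<in> {c<..<d} \<longrightarrow>
          ml_integral c \<alpha> \<beta> \<gamma> \<delta> \<omega>1 \<omega>2 (\<lambda>\<xi>. a * f \<xi> + b * g \<xi>) x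
          = a * ml_integral c \<alpha> \<beta> \<gamma> \<delta> \<omega>1 \<omega>2 f x + b * ml_integral c \<alpha> \<beta> \<gamma> \<delta> \<omega>1 \<omega>2 g x"
  using ml_integral_L1(1)[OF cd re f, of \<delta> \<omega>1 \<omega>2] ml_integral_L1(1)[OF cd re g, of \<delta> \<omega>1 \<omega>2]
proof eventually_elim
  case (elim x)
  show ?case
  proof
    assume "x \<in> {c<..<d}"
    with elim have int:
      "set_integrable lebesgue {c<..<x} (\<lambda>\<xi>. a * (ml_kernel \<alpha> \<beta> \<gamma> \<delta> \<omega>1 \<omega>2 (x - \<xi>) * f \<xi>))"
      "set_integrable lebesgue {c<..<x} (\<lambda>\<xi>. b * (ml_kernel \<alpha> \<beta> \<gamma> \<delta> \<omega>1 \<omega>2 (x - \<xi>) * g \<xi>))"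
      by (auto intro!: set_integrable_mult_right)
    have split: "ml_kernel \<alpha> \<beta> \<gamma> \<delta> \<omega>1 \<omega>2 (x - \<xi>) * (a * f \<xi> + b * g \<xi>)
        = a * (ml_kernel \<alpha> \<beta> \<gamma> \<delta> \<omega>1 \<omega>2 (x - \<xi>) * f \<xi>)
          + b * (ml_kernel \<alpha> \<beta> \<gamma> \<delta> \<omega>1 \<omega>2 (x - \<xi>) * g \<xi>)" for \<xi>
      by (simp add: algebra_simps)
    show "ml_integral c \<alpha> \<beta> \<gamma> \<delta> \<omega>1 \<omega>2 (\<lambda>\<xi>. a * f \<xi> + b * g \<xi>) x
        = a * ml_integral c \<alpha> \<beta> \<gamma> \<delta> \<omega>1 \<omega>2 f x + b * ml_integral c \<alpha> \<beta> \<gamma> \<delta> \<omega>1 \<omega>2 g x"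
      unfolding ml_integral_def split set_integral_add(2)[OF int] by simp
  qed
qed

theorem theorem3p4:
  fixes c d :: real and \<alpha> \<beta> \<gamma> \<delta> \<omega>1 \<omega>2 :: complex
  assumes "c < d" and "Re \<alpha> > 0" and "Re \<beta> > 0" and "Re \<gamma> > 0"
  shows "(\<lambda>(k, l). ml_bound_term c d \<alpha> \<beta> \<gamma> \<delta> \<omega>1 \<omega>2 k l) summable_on UNIV \<and>
    (\<forall>f. f absolutely_integrable_on {c<..<d} \<longrightarrow>
       (AE x in lebesgue. x \<in> {c<..<d} \<longrightarrow>
          (\<lambda>\<xi>. ml_kernel \<alpha> \<beta> \<gamma> \<delta> \<omega>1 \<omega>2 (x - \<xi>) * f \<xi>) absolutely_integrable_on {c<..<x}) \<and>
       ml_integral c \<alpha> \<beta> \<gamma> \<delta> \<omega>1 \<omega>2 f absolutely_integrable_on {c<..<d} \<and>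
       L1_norm c d (ml_integral c \<alpha> \<beta> \<gamma> \<delta> \<omega>1 \<omega>2 f)
         \<le> ml_bound c d \<alpha> \<beta> \<gamma> \<delta> \<omega>1 \<omega>2 * L1_norm c d f) \<and>
    (\<forall>f g a b. f absolutely_integrable_on {c<..<d} \<longrightarrow> g absolutely_integrable_on {c<..<d} \<longrightarrow>
       (AE x in lebesgue. x \<in> {c<..<d} \<longrightarrow>
          ml_integral c \<alpha> \<beta> \<gamma> \<delta> \<omega>1 \<omega>2 (\<lambda>\<xi>. a * f \<xi> + b * g \<xi>) x
          = a * ml_integral c \<alpha> \<beta> \<gamma> \<delta> \<omega>1 \<omega>2 f x + b * ml_integral c \<alpha> \<beta> \<gamma> \<delta> \<omega>1 \<omega>2 g x))"
  by (intro conjI allI impI ml_bound_term_summable_on[OF assms] ml_integral_L1[OF assms]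
        ml_integral_linear[OF assms])

end
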